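(* Let $k\ge3$ be fixed. For $G\in\mathcal{X}_{n,k}$, the (normalized) minimal norm $\nu(G)$ of the Jacobian of $G$ satisfies $$\nu(G)=O(\log_{k-1}n)\qquad (n\to\infty),$$ that is, there is a constant $C$ depending only on $k$ such that $\nu(G)\le C\log_{k-1}n$ for all $n$ and all $G\in\mathcal{X}_{n,k}$.
   Context: $\mathcal{X}_{n,k}$ is the set of finite simple connected $k$-regular graphs with $n$ vertices. For a graph $G$ with oriented edges, the lattice of integral flows $\Lambda^1(G)\subset\mathbf{R}^{E(G)}$ consists of the integer-valued functions on edges for which inflow equals outflow at every vertex, with the Euclidean inner product; for $G\in\mathcal{X}_{n,k}$ it has dimension $kn/2-n+1$. Its determinant is the number $\tau(G)$ of spanning trees of $G$, and its (unnormalized) minimal norm (minimal value of the squared length of a nonzero vector) is the girth $\gamma(G)$. The Jacobian of $G$ is the finite group $(\Lambda^1)^{\#}/\Lambda^1$, where $(\Lambda^1)^{\#}$ is the dual lattice. The normalized minimal norm is defined by $$\nu(G)=\gamma(G)\,\tau(G)^{2/(kn/2-n+1)} .$$ *)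

theory Defs
  imports Complex_Main "Graph_Theory.Digraph_Component"
begin

text \<open>
  A finite simple graph is a \<^locale>\<open>pair_graph\<close>: a finite loop-free set of vertex pairs that is
  closed under reversal, so that every undirected edge \<open>{u, v}\<close> is represented by the two arcs
  \<open>(u, v)\<close> and \<open>(v, u)\<close>.  The degree of a vertex is then its out-degree.
\<close>

definition regular_graphs :: "nat \<Rightarrow> nat \<Rightarrow> 'a pair_pre_digraph set" where
  "regular_graphs n k =
    {G. pair_graph G
      \<and> Digraph_Component.connected (with_proj G)
      \<and> card (pverts G) = n
      \<and> (\<forall>v \<in> pverts G. out_degree (with_proj G) v = k)}"

text \<open>
  In a symmetric digraph the library's directed cycles include the walks \<open>u, v, u\<close> along a single
  undirected edge.  Requiring length at least 3 removes exactly these.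
\<close>

definition undirected_cycle :: "'a pair_pre_digraph \<Rightarrow> ('a \<times> 'a) awalk \<Rightarrow> bool" where
  "undirected_cycle G p \<longleftrightarrow> pre_digraph.cycle (with_proj G) p \<and> 3 \<le> length p"

text \<open>The value is only meaningful if \<open>G\<close> has a cycle (for a forest it is 0).\<close>

definition girth :: "'a pair_pre_digraph \<Rightarrow> nat" where
  "girth G = Inf {length p | p. undirected_cycle G p}"

text \<open>
  The library's \<^const>\<open>spanning_tree\<close> excludes directed cycles only; on symmetric digraphs it is
  not the undirected notion, since it forbids \<open>u, v, u\<close> and admits oriented subgraphs.  Here
  spanning trees are symmetric subgraphs without undirected cycles, so that each undirected
  spanning tree is counted once.
\<close>

definition spanning_trees :: "'a pair_pre_digraph \<Rightarrow> 'a pair_pre_digraph set" where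
  "spanning_trees G =
    {T. pair_graph T
      \<and> spanning (with_proj T) (with_proj G)
      \<and> Digraph_Component.connected (with_proj T)
      \<and> (\<nexists>p. undirected_cycle T p)}"

definition num_spanning_trees :: "'a pair_pre_digraph \<Rightarrow> nat" where
  "num_spanning_trees G = card (spanning_trees G)"

text \<open>
  The normalized minimal norm of the Jacobian of \<open>G \<in> regular_graphs n k\<close>; \<open>k n / 2 - n + 1\<close>
  is the dimension of the lattice of integral flows of \<open>G\<close>.
\<close>

definition normalized_min_norm :: "nat \<Rightarrow> nat \<Rightarrow> 'a pair_pre_digraph \<Rightarrow> real" where
  "normalized_min_norm n k G =
    real (girth G) * real (num_spanning_trees G) powr (2 / (real k * real n / 2 - real n + 1))"

end

theory Submission
  imports Defs
begin

text \<open>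
  The dimension of the flow lattice is at least \<open>(k - 2) n / 2\<close>, while a spanning tree is determined
  by its arcs, so \<open>\<tau>(G) \<le> 2\<^bsup>kn\<^esup>\<close>; hence the factor \<open>\<tau>(G)\<^bsup>2/dim\<^esup>\<close> is bounded in terms of
  \<open>k\<close> alone.  For the girth, there are at least \<open>2\<^bsup>r\<^esup>\<close> non-backtracking walks with \<open>r + 1\<close> arcs
  that end with a given arc.  Once \<open>2\<^bsup>r\<^esup> > n\<close>, two of them start at the same vertex; where they
  first diverge, the reverse of one tail followed by the other tail is a closed non-backtracking
  walk of length at most \<open>2 (r + 1)\<close>.  A shortest closed non-backtracking walk is a cycle.
\<close>

section \<open>Non-backtracking walks\<close>

definition nb_step :: "'a \<times> 'a \<Rightarrow> 'a \<times> 'a \<Rightarrow> bool" where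
  "nb_step e f \<longleftrightarrow> snd e = fst f \<and> fst e \<noteq> snd f"

definition nb_walk :: "'a rel \<Rightarrow> ('a \<times> 'a) list \<Rightarrow> bool" where
  "nb_walk E p \<longleftrightarrow> p \<noteq> [] \<and> set p \<subseteq> E \<and> successively nb_step p"

text \<open>Backtracking is allowed at the closing vertex: the first arc may be the reverse of the
  last. This weak form arises when two walks with the same last arc are joined, and it passes to the
  segment between two visits to a vertex.\<close>

definition nb_closed :: "'a rel \<Rightarrow> ('a \<times> 'a) list \<Rightarrow> bool" where
  "nb_closed E p \<longleftrightarrow> nb_walk E p \<and> fst (hd p) = snd (last p)"

lemma nb_walk_Cons:
  "nb_walk E (e # p) \<longleftrightarrow> e \<in> E \<and> (p = [] \<or> nb_step e (hd p) \<and> nb_walk E p)"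
  by (auto simp: nb_walk_def successively_Cons)

lemma nb_walk_append:
  assumes "p \<noteq> []" "q \<noteq> []"
  shows "nb_walk E (p @ q) \<longleftrightarrow> nb_walk E p \<and> nb_walk E q \<and> nb_step (last p) (hd q)"
  using assms by (auto simp: nb_walk_def successively_append_iff)

lemma nb_walk_rev:
  assumes "sym E" "nb_walk E p"
  shows "nb_walk E (rev (map prod.swap p))"
proof -
  have "successively (\<lambda>e f. nb_step (prod.swap f) (prod.swap e)) p"
    using assms(2) by (auto simp: nb_walk_def nb_step_def elim: successively_mono)
  then show ?thesis
    using assms by (auto simp: nb_walk_def successively_map dest: symD)
qed

lemma nb_walks_diverge_imp_closed:
  assumes "sym E" and p: "nb_walk E p" and q: "nb_walk E q"
    and "p \<noteq> q" and len: "length p = length q"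
    and start: "fst (hd p) = fst (hd q)" and fin: "snd (last p) = snd (last q)"
  shows "\<exists>c. nb_closed E c \<and> length c \<le> 2 * length p"
proof -
  obtain pre x p' y q' where "x \<noteq> y" and pe: "p = pre @ x # p'" and qe: "q = pre @ y # q'"
    using same_length_different[OF \<open>p \<noteq> q\<close> len] by (metis append_Cons append_Nil)
  have w: "nb_walk E (x # p')" "nb_walk E (y # q')"
    using p q by (cases "pre = []"; simp add: pe qe nb_walk_append)+
  have "fst x = fst y"
    using p q start by (cases "pre = []") (auto simp: pe qe nb_walk_append nb_step_def)
  with \<open>x \<noteq> y\<close> have "snd x \<noteq> snd y" by (auto simp: prod_eq_iff)
  \<comment> \<open>At the point of divergence, \<open>snd x \<noteq> snd y\<close> prevents
    backtracking. The walk closes up at the common end of \<open>p\<close> and \<open>q\<close>,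
    where \<open>nb_closed\<close> permits it.\<close>
  let ?c = "rev (map prod.swap (x # p')) @ (y # q')"
  have "nb_walk E ?c"
    using nb_walk_rev[OF \<open>sym E\<close> w(1)] w(2) \<open>fst x = fst y\<close> \<open>snd x \<noteq> snd y\<close>
    by (subst nb_walk_append) (auto simp: nb_step_def)
  moreover have "fst (hd ?c) = snd (last ?c)"
    using fin by (auto simp: pe qe hd_append hd_rev last_map)
  ultimately have "nb_closed E ?c" unfolding nb_closed_def by blast
  moreover have "length ?c \<le> 2 * length p" using len by (simp add: pe qe)
  ultimately show ?thesis by blast
qed

text \<open>If two arcs leave the same vertex, the segment from the first of them until just before
  the second is itself closed and non-backtracking, and strictly shorter.\<close>

lemma shortest_nb_closed_distinct:
  assumes c: "nb_closed E c" and min: "\<And>d. nb_closed E d \<Longrightarrow> length c \<le> length d"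
  shows "distinct (map fst c)"
proof (rule ccontr)
  assume "\<not> distinct (map fst c)"
  then obtain xs ys zs v where "map fst c = xs @ [v] @ ys @ [v] @ zs"
    using not_distinct_decomp by blast
  then obtain xs' e ys' f zs' where ce: "c = xs' @ (e # ys') @ f # zs'" and "fst e = fst f"
    by (fastforce simp: map_eq_append_conv map_eq_Cons_conv append_eq_map_conv Cons_eq_map_conv)
  have "nb_walk E ((e # ys') @ f # zs')"
    using c by (cases "xs' = []") (auto simp: ce nb_closed_def nb_walk_append)
  then have "nb_walk E (e # ys')" "nb_step (last (e # ys')) f"
    by (subst (asm) nb_walk_append; simp)+
  then have "nb_closed E (e # ys')"
    using \<open>fst e = fst f\<close> by (simp add: nb_closed_def nb_step_def)
  from min[OF this] show False by (simp add: ce)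
qed

text \<open>Length 1 would be a loop; at length 2, closing up would make the second arc the reverse
  of the first.\<close>

lemma nb_closed_length_ge_3:
  assumes "irrefl E" "nb_closed E c"
  shows "3 \<le> length c"
proof (rule ccontr)
  assume "\<not> 3 \<le> length c"
  moreover have "c \<noteq> []" using assms(2) by (simp add: nb_closed_def nb_walk_def)
  ultimately consider e where "c = [e]" | e f where "c = [e, f]"
    by (cases c rule: list.exhaust; cases "tl c" rule: list.exhaust; cases "tl (tl c)") auto
  then show False
    using assms by cases (auto simp: nb_closed_def nb_walk_def nb_step_def irrefl_def)
qed

text \<open>Since \<open>c\<close> itself may revisit vertices, the cycle is taken to be a closed
  non-backtracking walk \<open>d\<close> of minimal length in the whole graph.\<close>

lemma (in pair_graph) nb_closed_imp_undirected_cycle: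
  assumes "nb_closed (parcs G) c"
  shows "\<exists>p. undirected_cycle G p \<and> length p \<le> length c"
proof -
  obtain d where d: "nb_closed (parcs G) d"
    and min: "\<And>c. nb_closed (parcs G) c \<Longrightarrow> length d \<le> length c"
    using ex_has_least_nat[of "nb_closed (parcs G)" c length] assms by blast
  have walk: "nb_walk (parcs G) d" and closed: "fst (hd d) = snd (last d)"
    using d by (auto simp: nb_closed_def)
  then have ne: "d \<noteq> []" and arcs: "set d \<subseteq> parcs G" by (auto simp: nb_walk_def)
  have cas: "pcas (fst (hd p)) p (snd (last p))" if "nb_walk E p" for p and E :: "'a rel"
  proof (use that in \<open>induction p\<close>)
    case (Cons e p)
    then show ?case by (cases p) (auto simp: nb_walk_Cons nb_step_def)
  qed (simp add: nb_walk_def)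
  have "awalk (fst (hd d)) d (fst (hd d))"
    using cas[OF walk] closed arcs arc_fst_in_verts[of "hd d"] hd_in_set[OF ne]
    by (auto simp: awalk_def)
  \<comment> \<open>\<open>cycle\<close> asks for distinct vertices after the first is dropped; for
    a closed walk these are the start vertices of the arcs, rotated by one.\<close>
  moreover have "tl (pawalk_verts u d) = rotate1 (map fst d)" for u
  proof -
    have "pawalk_verts u d = map fst d @ [snd (last d)]"
      using awalk_verts_conv[of u d] ne by simp
    then show ?thesis using ne closed by (cases d) auto
  qed
  ultimately have "cycle d"
    using shortest_nb_closed_distinct[OF d min] ne unfolding cycle_def by auto
  moreover have "3 \<le> length d"
    using d no_loops' by (intro nb_closed_length_ge_3[of "parcs G"]) (auto simp: irrefl_def)
  ultimately show ?thesis
    using min[OF assms] by (auto simp: undirected_cycle_def)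
qed

section \<open>The girth\<close>

text \<open>Walks are grown backwards from the fixed last arc \<open>e\<close>, so all end at the
  same vertex; \<open>r\<close> counts the arcs put in front of \<open>e\<close>.\<close>

definition nb_walks_to :: "'a rel \<Rightarrow> 'a \<times> 'a \<Rightarrow> nat \<Rightarrow> ('a \<times> 'a) list set" where
  "nb_walks_to E e r = {p. nb_walk E p \<and> last p = e \<and> length p = Suc r}"

lemma card_nb_walks_to:
  assumes "finite E" "sym E" "e \<in> E"
    and deg: "\<And>x. x \<in> Domain E \<Longrightarrow> 3 \<le> card (E `` {x})"
  shows "2 ^ r \<le> card (nb_walks_to E e r)"
proof (induction r)
  case 0
  have "nb_walks_to E e 0 = {[e]}"
    using \<open>e \<in> E\<close> by (auto simp: nb_walks_to_def nb_walk_def length_Suc_conv)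
  then show ?case by simp
next
  case (Suc r)
  define W where "W = nb_walks_to E e r"
  \<comment> \<open>These arcs can be put in front of \<open>p\<close>: by symmetry each neighbour
    of its first vertex supplies one, and removing the second vertex of \<open>p\<close> forbids
    backtracking. Degree at least 3 leaves two choices.\<close>
  define ext where "ext p = (\<lambda>u. (u, fst (hd p))) ` (E `` {fst (hd p)} - {snd (hd p)})" for p
  have fin: "finite (nb_walks_to E e r)" for r
    by (rule finite_subset[OF _ finite_lists_length_eq[OF \<open>finite E\<close>, of "Suc r"]])
      (auto simp: nb_walks_to_def nb_walk_def)
  have finE: "finite (E `` {x})" for x
    using \<open>finite E\<close> by (rule finite_Image)
  have "2 \<le> card (ext p)" if "p \<in> W" for p
  proof -
    have "hd p \<in> E" using that by (auto simp: W_def nb_walks_to_def nb_walk_def)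
    then have "3 \<le> card (E `` {fst (hd p)})" by (intro deg) (auto simp: Domain_fst)
    moreover have "card (ext p) = card (E `` {fst (hd p)} - {snd (hd p)})"
      unfolding ext_def by (intro card_image) (auto simp: inj_on_def)
    ultimately show ?thesis using finE by (auto simp: card_Diff_singleton_if)
  qed
  then have "card W * 2 \<le> (\<Sum>p\<in>W. card (ext p))"
    using sum_bounded_below[of W 2 "\<lambda>p. card (ext p)"] by simp
  also have "\<dots> = card (SIGMA p:W. ext p)"
    using fin finE by (subst card_SigmaI) (auto simp: W_def ext_def)
  also have "\<dots> = card ((\<lambda>(p, a). a # p) ` (SIGMA p:W. ext p))"
    by (intro card_image[symmetric]) (auto simp: inj_on_def)
  also have "\<dots> \<le> card (nb_walks_to E e (Suc r))"
  proof (rule card_mono[OF fin], safe)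
    fix p a b assume "p \<in> W" "(a, b) \<in> ext p"
    then show "(a, b) # p \<in> nb_walks_to E e (Suc r)"
      using \<open>sym E\<close>
      by (auto simp: W_def ext_def nb_walks_to_def nb_walk_def successively_Cons nb_step_def dest: symD)
  qed
  finally show ?case using Suc.IH by (simp add: W_def)
qed

lemma (in pair_graph) girth_le_if_card_less:
  assumes "parcs G \<noteq> {}" and deg: "\<And>v. v \<in> pverts G \<Longrightarrow> 3 \<le> out_degree (with_proj G) v"
    and less: "card (pverts G) < 2 ^ r"
  shows "girth G \<le> 2 * Suc r"
proof -
  obtain e where "e \<in> parcs G" using assms(1) by auto
  have sym: "sym (parcs G)" using arcs_symmetric by (auto intro: symI)
  have "3 \<le> card (parcs G `` {x})" if "x \<in> Domain (parcs G)" for x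
  proof -
    have "out_arcs (with_proj G) x = Pair x ` (parcs G `` {x})"
      by (auto simp: out_arcs_def)
    then have "out_degree (with_proj G) x = card (parcs G `` {x})"
      by (simp add: out_degree_def card_image inj_on_def)
    then show ?thesis using deg[of x] that in_arcsD1 by auto
  qed
  from card_nb_walks_to[OF pair_finite_arcs sym \<open>e \<in> parcs G\<close> this]
  have "card (pverts G) < card (nb_walks_to (parcs G) e r)"
    using less by (meson le_trans not_le)
  moreover have "(\<lambda>p. fst (hd p)) ` nb_walks_to (parcs G) e r \<subseteq> pverts G"
    by (auto simp: nb_walks_to_def nb_walk_def intro!: arc_fst_in_verts)
  ultimately have "\<not> inj_on (\<lambda>p. fst (hd p)) (nb_walks_to (parcs G) e r)"
    using card_inj_on_le pair_finite_verts by (metis not_le)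
  then obtain p q where pq: "p \<in> nb_walks_to (parcs G) e r" "q \<in> nb_walks_to (parcs G) e r"
    "fst (hd p) = fst (hd q)" "p \<noteq> q" by (auto simp: inj_on_def)
  then obtain c where "nb_closed (parcs G) c" "length c \<le> 2 * Suc r"
    using nb_walks_diverge_imp_closed[OF sym, of p q] by (auto simp: nb_walks_to_def)
  then obtain d where "undirected_cycle G d" "length d \<le> 2 * Suc r"
    using nb_closed_imp_undirected_cycle le_trans by blast
  then show ?thesis
    unfolding girth_def by (intro le_trans[OF wellorder_Inf_le1[of "length d"]]) auto
qed

lemma (in pair_graph) girth_le_log:
  assumes "pverts G \<noteq> {}" and deg: "\<And>v. v \<in> pverts G \<Longrightarrow> 3 \<le> out_degree (with_proj G) v"
  shows "girth G \<le> 6 * log 2 (card (pverts G))" and "2 \<le> card (pverts G)"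
proof -
  obtain v where "v \<in> pverts G" using assms(1) by blast
  then have "out_arcs (with_proj G) v \<noteq> {}" using deg by (force simp: out_degree_def)
  then obtain u where u: "(v, u) \<in> parcs G" by (auto simp: out_arcs_def)
  then have "{v, u} \<subseteq> pverts G" "v \<noteq> u" using wellformed' no_loops' by auto
  then show n2: "2 \<le> card (pverts G)"
    using card_mono[OF pair_finite_verts, of "{v, u}"] by simp
  define n where "n = card (pverts G)"
  \<comment> \<open>The least \<open>r\<close> with \<open>n < 2 ^ r\<close>.\<close>
  define r where "r = Suc (nat \<lfloor>log 2 n\<rfloor>)"
  have l1: "1 \<le> log 2 n" using n2 by (simp add: n_def le_log_iff)
  have r: "log 2 n < r" "r \<le> log 2 n + 1" using l1 by (simp_all add: r_def) linarith+
  have "real n = 2 powr log 2 n" using n2 by (simp add: n_def)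
  also have "\<dots> < 2 powr r" using r by simp
  also have "\<dots> = real (2 ^ r)" by (simp add: powr_realpow)
  finally have "n < 2 ^ r" by (simp only: of_nat_less_iff)
  then have "girth G \<le> 2 * Suc r"
    using u by (intro girth_le_if_card_less deg) (auto simp: n_def)
  then have "real (girth G) \<le> real (2 * Suc r)" by (rule of_nat_mono)
  \<comment> \<open>Here \<open>2 * (r + 1) \<le> 2 * log 2 n + 4\<close>, and
    \<open>1 \<le> log 2 n\<close> absorbs the 4 into the factor 6.\<close>
  then show "girth G \<le> 6 * log 2 (card (pverts G))" using r l1 by (simp add: n_def)
qed

section \<open>Spanning trees\<close>

text \<open>A spanning tree has the vertex set of \<open>G\<close>, so its arc set, one of the
  subsets of at most \<open>k * n\<close> arcs, identifies it. This crude count suffices because the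
  exponent \<open>2 / d\<close> is of order \<open>1 / n\<close>.\<close>

lemma (in pair_graph) num_spanning_trees_le:
  assumes "\<And>v. v \<in> pverts G \<Longrightarrow> out_degree (with_proj G) v \<le> k"
  shows "num_spanning_trees G \<le> 2 ^ (k * card (pverts G))"
proof -
  have "parcs G \<subseteq> (\<Union>v\<in>pverts G. out_arcs (with_proj G) v)"
    by (auto simp: out_arcs_def dest: in_arcsD1)
  then have "card (parcs G) \<le> card (\<Union>v\<in>pverts G. out_arcs (with_proj G) v)"
    using pair_finite_verts finite_out_arcs by (intro card_mono) auto
  also have "\<dots> \<le> (\<Sum>v\<in>pverts G. card (out_arcs (with_proj G) v))"
    by (rule card_UN_le[OF pair_finite_verts])
  also have "\<dots> \<le> card (pverts G) * k"
    using sum_bounded_above[of "pverts G" _ k] assms by (simp add: out_degree_def)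
  finally have arcs: "card (parcs G) \<le> k * card (pverts G)" by (simp add: mult.commute)
  have "inj_on parcs (spanning_trees G)"
    by (auto simp: inj_on_def spanning_trees_def spanning_def)
  moreover have "parcs ` spanning_trees G \<subseteq> Pow (parcs G)"
    by (auto simp: spanning_trees_def spanning_def subgraph_def)
  ultimately have "num_spanning_trees G \<le> card (Pow (parcs G))"
    unfolding num_spanning_trees_def using pair_finite_arcs by (intro card_inj_on_le) auto
  also have "\<dots> \<le> 2 ^ (k * card (pverts G))"
    using arcs pair_finite_arcs by (simp add: card_Pow)
  finally show ?thesis .
qed

theorem proposition4p4:
  fixes k :: nat
  assumes "k \<ge> 3"
  shows "\<exists>C::real. \<forall>n::nat. \<forall>G \<in> (regular_graphs n k :: 'a pair_pre_digraph set).
    normalized_min_norm n k G \<le> C * log (real (k - 1)) (real n)"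
\<comment> \<open>The constant stays schematic here and is fixed by the final \<open>show\<close>;
  it mentions only \<open>k\<close>.\<close>
proof (intro exI allI ballI)
  fix n and G :: "'a pair_pre_digraph"
  assume G: "G \<in> regular_graphs n k"
  \<comment> \<open>The exponent comes from \<open>d > (k - 2) * n / 2\<close>, which gives
    \<open>k * n * (2 / d) \<le> 4 * k / (k - 2)\<close>.\<close>
  define K where "K = (2::real) powr (4 * k / (k - 2))"
  define d where "d = real k * real n / 2 - real n + 1"
  interpret pair_graph G using G by (simp add: regular_graphs_def)
  have n: "card (pverts G) = n" and deg: "\<And>v. v \<in> pverts G \<Longrightarrow> out_degree (with_proj G) v = k"
    and "pverts G \<noteq> {}"
    using G by (auto simp: regular_graphs_def connected_def strongly_connected_def)
  then have girth: "girth G \<le> 6 * log 2 n" and "2 \<le> n"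
    using girth_le_log assms by simp_all
  have d: "d = (k - 2) * n / 2 + 1" using assms by (simp add: d_def of_nat_diff field_simps)
  have "d > 0" by (simp add: d add_nonneg_pos)
  have "real (num_spanning_trees G) \<le> 2 ^ (k * n)"
    using num_spanning_trees_le[of k] deg n by (simp add: of_nat_le_iff[symmetric] del: of_nat_le_iff)
  then have "real (num_spanning_trees G) powr (2 / d) \<le> (2 ^ (k * n)) powr (2 / d)"
    using \<open>d > 0\<close> by (intro powr_mono2) auto
  also have "\<dots> = 2 powr (real (k * n) * (2 / d))"
    by (simp add: powr_powr flip: powr_realpow)
  also have "\<dots> \<le> K"
    unfolding K_def using assms \<open>d > 0\<close> by (intro powr_mono) (auto simp: d field_simps)
  finally have "normalized_min_norm n k G \<le> 6 * log 2 n * K"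
    unfolding normalized_min_norm_def d_def[symmetric] using girth by (intro mult_mono) auto
  \<comment> \<open>Change of base from 2 to \<open>k - 1\<close>, which is at least 2, so its
    logarithm does not vanish.\<close>
  also have "6 * log 2 n * K = 6 * K * log 2 (k - 1) * log (k - 1) n"
    using assms by (simp add: log_def of_nat_diff)
  finally show "normalized_min_norm n k G
      \<le> 6 * 2 powr (4 * k / (k - 2)) * log 2 (k - 1) * log (real (k - 1)) (real n)"
    unfolding K_def .
qed

end
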